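(* Let $\mathbf{k}$ be a unitary commutative ring, let $\Omega$ be a nonempty set, and let $T\in Y_\infty(\Omega)\setminus\{|\}$ be a planar binary tree, different from $|$, with interior vertices decorated by $\Omega$. Then $$\Delta_{LR(\Omega)}(T)=\sum_{c\in \mathrm{Adm}_*(T)}P^c(T)\otimes R^c(T)=T\otimes |+|\otimes T+\sum_{c\in \mathrm{Adm}(T)}P^c(T)\otimes R^c(T).$$
   Context: All modules, linear maps and tensor products are over the unitary commutative ring $\mathbf{k}$. Decorated trees. For $n\ge 0$, $Y_n(\Omega)$ is the set of planar binary rooted trees with $n$ interior vertices (each interior vertex has exactly two children, left and right; such a tree has $n+1$ leaves), each interior vertex being decorated by an element of $\Omega$; leaves are not decorated. $Y_0(\Omega)=\{|\}$, where $|$ is the unique tree with one leaf and no interior vertex. Put $Y_\infty(\Omega)=\bigsqcup_{n\ge0}Y_n(\Omega)$ and let $H_{LR}(\Omega)=\mathbf{k}Y_\infty(\Omega)$ be the free $\mathbf{k}$-module on it. For $\alpha\in\Omega$ and trees $T_1,T_2$, the grafting $T_1\vee_\alpha T_2$ is the tree whose root vertex is decorated by $\alpha$, with left subtree $T_1$ and right subtree $T_2$; extend $\vee_\alpha$ bilinearly. Every $T\neq |$ is uniquely $T=T^l\vee_\alpha T^r$. Product. $\ast$ is the bilinear product on $H_{LR}(\Omega)$ defined recursively by $|\ast T=T\ast|=T$ and, for $T=T^l\vee_\alpha T^r$, $T'=T'^l\vee_\beta T'^r$, $$T\ast T'=T^l\vee_\alpha(T^r\ast T')+(T\ast T'^l)\vee_\beta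 T'^r .$$ It is associative with unit $|$. Coproduct. $\Delta_{LR(\Omega)}:H_{LR}(\Omega)\to H_{LR}(\Omega)\otimes H_{LR}(\Omega)$ is the linear map defined recursively by $\Delta_{LR(\Omega)}(|)=|\otimes|$ and $$\Delta_{LR(\Omega)}(T^l\vee_\alpha T^r)=(T^l\vee_\alpha T^r)\otimes|+(\ast,\vee_\alpha)\bigl(\Delta_{LR(\Omega)}(T^l)\otimes\Delta_{LR(\Omega)}(T^r)\bigr),$$ where $(\ast,\vee_\alpha)=(\ast\otimes\vee_\alpha)\circ\tau_{23}$ and $\tau_{23}$ exchanges the second and third tensor factors. Cuts. Let $T\in Y_\infty(\Omega)\setminus\{|\}$. A (non-total) cut $c$ of $T$ is a (possibly empty) set of edges of $T$ each of which connects two interior vertices of $T$ (edges ending in a leaf are not allowed). It is admissible if every path from a vertex of the tree to the root meets at most one edge of $c$; the empty cut is admissible. For an admissible cut $c$, cut each edge of $c$ into two edges: the lower half becomes a leaf edge of the lower component and the upper half becomes the root edge of the upper component, so that every resulting component is again a decorated planar binary tree. $R^c(T)$ is the component containing the root of $T$, and $P^c(T)$ is the product with respect to $\ast$, taken from left to right, of the other components (so for the empty cut $P^c(T)=|$ and $R^c(T)=T$). In addition there is by convention one more admissible cut, the total cut, with $R^c(T)=|$ and $P^c(T)=T$. $\mathrm{Adm}_*(T)$ is the set of all admissible cuts (including the empty cut and the total cut), and $\mathrm{Adm}(T)=\mathrm{Adm}_*(T)\setminus\{\text{empty cut},\text{total cut}\}$. *)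

theory Defs
  imports
    Complex_Main
    "HOL-Library.Tree"
    "HOL-Library.Poly_Mapping"
    "HOL-Library.Sublist"
    "HOL-Library.List_Lexorder"
begin

section \<open>Free modules, linear extension and tensor products\<close>

text \<open>
  The free module over a commutative ring \<open>'k\<close> on the set of all elements of \<open>'a\<close> is
  \<open>'a \<Rightarrow>\<^sub>0 'k\<close>; addition comes from \<^theory>\<open>HOL-Library.Poly_Mapping\<close>.
\<close>

definition fscale :: "'k::comm_ring_1 \<Rightarrow> ('a \<Rightarrow>\<^sub>0 'k) \<Rightarrow> ('a \<Rightarrow>\<^sub>0 'k)"
  where "fscale c x = Poly_Mapping.map ((*) c) x"

definition basis :: "'a \<Rightarrow> ('a \<Rightarrow>\<^sub>0 'k::comm_ring_1)"
  where "basis a = Poly_Mapping.single a 1"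

definition lin_ext :: "('a \<Rightarrow> ('b \<Rightarrow>\<^sub>0 'k)) \<Rightarrow> ('a \<Rightarrow>\<^sub>0 'k::comm_ring_1) \<Rightarrow> ('b \<Rightarrow>\<^sub>0 'k)"
  where "lin_ext f x = (\<Sum>a\<in>Poly_Mapping.keys x. fscale (Poly_Mapping.lookup x a) (f a))"

text \<open>
  The tensor product of the free modules on \<open>'a\<close> and \<open>'b\<close> is realised as the free module on
  \<open>'a \<times> 'b\<close>, with \<open>basis a \<otimes> basis b = basis (a, b)\<close>; the universal property is
  \<open>tensor_universal\<close> below.
\<close>

definition tensor :: "('a \<Rightarrow>\<^sub>0 'k::comm_ring_1) \<Rightarrow> ('b \<Rightarrow>\<^sub>0 'k) \<Rightarrow> ('a \<times> 'b \<Rightarrow>\<^sub>0 'k)"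
    (infixr \<open>\<otimes>\<close> 70)
  where "x \<otimes> y = (\<Sum>a\<in>Poly_Mapping.keys x. \<Sum>b\<in>Poly_Mapping.keys y.
           Poly_Mapping.single (a, b) (Poly_Mapping.lookup x a * Poly_Mapping.lookup y b))"

definition bilin_ext ::
    "('a \<Rightarrow> 'b \<Rightarrow> ('c \<Rightarrow>\<^sub>0 'k)) \<Rightarrow> ('a \<Rightarrow>\<^sub>0 'k::comm_ring_1) \<Rightarrow> ('b \<Rightarrow>\<^sub>0 'k) \<Rightarrow> ('c \<Rightarrow>\<^sub>0 'k)"
  where "bilin_ext f x y = lin_ext (\<lambda>(a, b). f a b) (x \<otimes> y)"

text \<open>
  \<open>tensor_maps f g\<close> is the linear map induced by a pair of bilinear maps \<open>f\<close> and \<open>g\<close>, each regarded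
  as a linear map on a tensor product.
\<close>

definition tensor_maps ::
    "(('a \<Rightarrow>\<^sub>0 'k) \<Rightarrow> ('b \<Rightarrow>\<^sub>0 'k) \<Rightarrow> ('c \<Rightarrow>\<^sub>0 'k)) \<Rightarrow>
     (('d \<Rightarrow>\<^sub>0 'k) \<Rightarrow> ('e \<Rightarrow>\<^sub>0 'k) \<Rightarrow> ('f \<Rightarrow>\<^sub>0 'k)) \<Rightarrow>
     (('a \<times> 'b) \<times> ('d \<times> 'e) \<Rightarrow>\<^sub>0 'k::comm_ring_1) \<Rightarrow> ('c \<times> 'f \<Rightarrow>\<^sub>0 'k)"
  where "tensor_maps f g =
    lin_ext (\<lambda>((a, b), (d, e)). f (basis a) (basis b) \<otimes> g (basis d) (basis e))"

definition tau23 ::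
    "(('a \<times> 'b) \<times> ('c \<times> 'd) \<Rightarrow>\<^sub>0 'k::comm_ring_1) \<Rightarrow> (('a \<times> 'c) \<times> ('b \<times> 'd) \<Rightarrow>\<^sub>0 'k)"
  where "tau23 = lin_ext (\<lambda>((a, b), (c, d)). basis ((a, c), (b, d)))"

lemma lookup_fscale [simp]: "Poly_Mapping.lookup (fscale c x) a = c * Poly_Mapping.lookup x a"
  by (simp add: fscale_def Poly_Mapping.map.rep_eq when_def)

lemma module_fscale: "module (fscale :: 'k::comm_ring_1 \<Rightarrow> ('a \<Rightarrow>\<^sub>0 'k) \<Rightarrow> _)"
  by unfold_locales (auto intro!: poly_mapping_eqI simp: lookup_add algebra_simps)

lemma lookup_basis: "Poly_Mapping.lookup (basis a) b = (if a = b then 1 else 0)"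
  by (simp add: basis_def lookup_single when_def)

lemma keys_basis [simp]: "Poly_Mapping.keys (basis a :: 'a \<Rightarrow>\<^sub>0 'k::comm_ring_1) = {a}"
  by (simp add: basis_def)

lemma lin_ext_superset:
  assumes "finite A" "Poly_Mapping.keys x \<subseteq> A"
  shows "lin_ext f x = (\<Sum>a\<in>A. fscale (Poly_Mapping.lookup x a) (f a))"
  unfolding lin_ext_def using assms
  by (intro sum.mono_neutral_left)
     (auto intro!: poly_mapping_eqI simp: in_keys_iff)

lemma lookup_lin_ext_superset:
  assumes "finite A" "Poly_Mapping.keys x \<subseteq> A"
  shows "Poly_Mapping.lookup (lin_ext f x) b
       = (\<Sum>a\<in>A. Poly_Mapping.lookup x a * Poly_Mapping.lookup (f a) b)"
  by (simp add: lin_ext_superset[OF assms] lookup_sum)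

lemma lin_ext_linear:
  fixes f :: "'a \<Rightarrow> ('b \<Rightarrow>\<^sub>0 'k::comm_ring_1)"
  shows "module_hom fscale fscale (lin_ext f)"
proof -
  interpret m: module "fscale :: 'k \<Rightarrow> ('b \<Rightarrow>\<^sub>0 'k) \<Rightarrow> _" by (rule module_fscale)
  have "lin_ext f (x + y) = lin_ext f x + lin_ext f y" for x y
  proof -
    let ?A = "Poly_Mapping.keys x \<union> Poly_Mapping.keys y"
    have "Poly_Mapping.keys (x + y) \<subseteq> ?A" by (rule keys_add)
    then show ?thesis
      by (simp add: lin_ext_superset[of ?A] lookup_add m.scale_left_distrib sum.distrib)
  qed
  moreover have "lin_ext f (fscale c x) = fscale c (lin_ext f x)" for c x
  proof -
    have "Poly_Mapping.keys (fscale c x) \<subseteq> Poly_Mapping.keys x"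
      by (auto simp: in_keys_iff)
    then show ?thesis
      by (simp add: lin_ext_superset[of "Poly_Mapping.keys x"] m.scale_sum_right)
  qed
  ultimately show ?thesis
    by (simp add: module_hom_iff module_fscale)
qed

lemma lin_ext_basis [simp]: "lin_ext f (basis a) = f a"
  by (auto intro!: poly_mapping_eqI simp: lin_ext_def lookup_basis)

lemma lookup_tensor [simp]:
  "Poly_Mapping.lookup (x \<otimes> y) (a, b) = Poly_Mapping.lookup x a * Poly_Mapping.lookup y b"
proof -
  have "Poly_Mapping.lookup (x \<otimes> y) (a, b) =
      (\<Sum>a'\<in>Poly_Mapping.keys x. \<Sum>b'\<in>Poly_Mapping.keys y.
        (if a' = a then if b' = b then Poly_Mapping.lookup x a' * Poly_Mapping.lookup y b' else 0 else 0))"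
    by (auto simp: tensor_def lookup_sum lookup_single when_def intro!: sum.cong)
  also have "\<dots> = (\<Sum>a'\<in>Poly_Mapping.keys x. if a' = a then \<Sum>b'\<in>Poly_Mapping.keys y.
        (if b' = b then Poly_Mapping.lookup x a' * Poly_Mapping.lookup y b' else 0) else 0)"
    by (intro sum.cong) auto
  also have "\<dots> = Poly_Mapping.lookup x a * Poly_Mapping.lookup y b"
    by (auto simp: in_keys_iff)
  finally show ?thesis .
qed

lemma tensor_basis [simp]: "basis a \<otimes> basis b = basis (a, b)"
  by (auto intro!: poly_mapping_eqI simp: lookup_basis)

lemma tensor_bilinear:
  "module_hom fscale fscale (\<lambda>x. x \<otimes> y)" "module_hom fscale fscale (\<lambda>y. x \<otimes> y)"
  by (auto simp: module_hom_iff module_fscale lookup_add algebra_simps intro!: poly_mapping_eqI)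

lemma basis_expansion: "x = (\<Sum>a\<in>Poly_Mapping.keys x. fscale (Poly_Mapping.lookup x a) (basis a))"
proof (rule poly_mapping_eqI)
  fix b
  have "(\<Sum>a\<in>Poly_Mapping.keys x. Poly_Mapping.lookup x a * (if a = b then 1 else 0)) =
      (\<Sum>a\<in>Poly_Mapping.keys x. if a = b then Poly_Mapping.lookup x a else 0)"
    by (intro sum.cong) auto
  then show "Poly_Mapping.lookup x b = Poly_Mapping.lookup
      (\<Sum>a\<in>Poly_Mapping.keys x. fscale (Poly_Mapping.lookup x a) (basis a)) b"
    by (auto simp: lookup_sum lookup_basis in_keys_iff)
qed

lemma tensor_universal:
  fixes B :: "('a \<Rightarrow>\<^sub>0 'k::comm_ring_1) \<Rightarrow> ('b \<Rightarrow>\<^sub>0 'k) \<Rightarrow> 'm::ab_group_add"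
  assumes B1: "\<And>y. module_hom fscale sm (\<lambda>x. B x y)"
    and B2: "\<And>x. module_hom fscale sm (\<lambda>y. B x y)"
  shows "\<exists>!g. module_hom fscale sm g \<and> (\<forall>x y. g (x \<otimes> y) = B x y)"
proof (rule ex_ex1I)
  interpret m: module sm using B1[of 0] by (simp add: module_hom_iff)
  define g where "g z = (\<Sum>p\<in>Poly_Mapping.keys z. sm (Poly_Mapping.lookup z p)
                           (B (basis (fst p)) (basis (snd p))))" for z :: "'a \<times> 'b \<Rightarrow>\<^sub>0 'k"
  have g: "g z = (\<Sum>p\<in>A. sm (Poly_Mapping.lookup z p) (B (basis (fst p)) (basis (snd p))))"
    if "finite A" "Poly_Mapping.keys z \<subseteq> A" for z A
    unfolding g_def using that
    by (intro sum.mono_neutral_left) (auto simp: in_keys_iff)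
  have "g (x + y) = g x + g y" for x y
    by (simp add: g[of "Poly_Mapping.keys x \<union> Poly_Mapping.keys y"] keys_add lookup_add
        m.scale_left_distrib sum.distrib)
  moreover have "g (fscale c x) = sm c (g x)" for c x
  proof -
    have "Poly_Mapping.keys (fscale c x) \<subseteq> Poly_Mapping.keys x"
      by (auto simp: in_keys_iff)
    then show ?thesis
      by (simp add: g[of "Poly_Mapping.keys x"] m.scale_sum_right)
  qed
  ultimately have lin: "module_hom fscale sm g"
    by (simp add: module_hom_iff module_fscale m.module_axioms)
  have "g (x \<otimes> y) = B x y" for x y
  proof -
    let ?X = "Poly_Mapping.keys x" and ?Y = "Poly_Mapping.keys y"
    have sub: "Poly_Mapping.keys (x \<otimes> y) \<subseteq> ?X \<times> ?Y"
      by (auto simp: in_keys_iff)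
    have "B x y = B (\<Sum>a\<in>?X. fscale (Poly_Mapping.lookup x a) (basis a)) y"
      using basis_expansion[of x] by simp
    also have "\<dots> = (\<Sum>a\<in>?X. sm (Poly_Mapping.lookup x a) (B (basis a) y))"
      by (simp add: module_hom.sum[OF B1] module_hom.scale[OF B1])
    also have "\<dots> = (\<Sum>a\<in>?X. sm (Poly_Mapping.lookup x a)
        (B (basis a) (\<Sum>b\<in>?Y. fscale (Poly_Mapping.lookup y b) (basis b))))"
      using basis_expansion[of y] by simp
    also have "\<dots> = (\<Sum>a\<in>?X. \<Sum>b\<in>?Y. sm (Poly_Mapping.lookup x a * Poly_Mapping.lookup y b)
        (B (basis a) (basis b)))"
      by (simp add: module_hom.sum[OF B2] module_hom.scale[OF B2] m.scale_sum_right)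
    also have "\<dots> = g (x \<otimes> y)"
      unfolding g[OF _ sub, simplified] sum.cartesian_product by (intro sum.cong) auto
    finally show ?thesis by simp
  qed
  with lin show "\<exists>g. module_hom fscale sm g \<and> (\<forall>x y. g (x \<otimes> y) = B x y)" by blast
next
  fix g h
  assume *: "module_hom fscale sm g \<and> (\<forall>x y. g (x \<otimes> y) = B x y)"
    "module_hom fscale sm h \<and> (\<forall>x y. h (x \<otimes> y) = B x y)"
  show "g = h"
  proof
    fix z
    have b: "g (basis p) = h (basis p)" for p
      using * by (cases p) (metis tensor_basis)
    have "g (\<Sum>p\<in>Poly_Mapping.keys z. fscale (Poly_Mapping.lookup z p) (basis p)) =
        h (\<Sum>p\<in>Poly_Mapping.keys z. fscale (Poly_Mapping.lookup z p) (basis p))"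
      using *[THEN conjunct1]
      by (simp add: module_hom.sum[of fscale sm] module_hom.scale[of fscale sm] b)
    then show "g z = h z" using basis_expansion[of z] by simp
  qed
qed


section \<open>The Loday--Ronco structure on decorated planar binary trees\<close>

text \<open>
  A planar binary rooted tree whose interior vertices are decorated by \<open>'a\<close> is an \<open>'a tree\<close>:
  \<open>\<langle>\<rangle>\<close> is the tree without interior vertex, \<open>\<langle>l, \<alpha>, r\<rangle>\<close> is \<open>l \<or>\<^bsub>\<alpha>\<^esub> r\<close>.
  The decoration set is the (nonempty) type \<open>'a\<close>.
\<close>

type_synonym ('a, 'k) H_LR = "'a tree \<Rightarrow>\<^sub>0 'k"

definition graft :: "'a \<Rightarrow> ('a, 'k::comm_ring_1) H_LR \<Rightarrow> ('a, 'k) H_LR \<Rightarrow> ('a, 'k) H_LR"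
  where "graft \<alpha> = bilin_ext (\<lambda>l r. basis \<langle>l, \<alpha>, r\<rangle>)"

fun ast_tree :: "'a tree \<Rightarrow> 'a tree \<Rightarrow> ('a, 'k::comm_ring_1) H_LR"
  where
    "ast_tree \<langle>\<rangle> T' = basis T'"
  | "ast_tree T \<langle>\<rangle> = basis T"
  | "ast_tree \<langle>l, \<alpha>, r\<rangle> \<langle>l', \<beta>, r'\<rangle> =
       graft \<alpha> (basis l) (ast_tree r \<langle>l', \<beta>, r'\<rangle>) + graft \<beta> (ast_tree \<langle>l, \<alpha>, r\<rangle> l') (basis r')"

definition ast :: "('a, 'k::comm_ring_1) H_LR \<Rightarrow> ('a, 'k) H_LR \<Rightarrow> ('a, 'k) H_LR"
    (infixr \<open>\<^bold>*\<close> 75)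
  where "ast = bilin_ext ast_tree"

primrec Delta_tree :: "'a tree \<Rightarrow> ('a tree \<times> 'a tree \<Rightarrow>\<^sub>0 'k::comm_ring_1)"
  where
    "Delta_tree \<langle>\<rangle> = basis \<langle>\<rangle> \<otimes> basis \<langle>\<rangle>"
  | "Delta_tree \<langle>l, \<alpha>, r\<rangle> = basis \<langle>l, \<alpha>, r\<rangle> \<otimes> basis \<langle>\<rangle>
       + tensor_maps ast (graft \<alpha>) (tau23 (Delta_tree l \<otimes> Delta_tree r))"

definition Delta_LR :: "('a, 'k::comm_ring_1) H_LR \<Rightarrow> ('a tree \<times> 'a tree \<Rightarrow>\<^sub>0 'k)"
  where "Delta_LR = lin_ext Delta_tree"


section \<open>Admissible cuts\<close>

text \<open>
  A vertex is addressed by the path leading to it from the root: a list of booleans, where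
  \<open>False\<close> means left child and \<open>True\<close> means right child.  An edge is identified with the address
  of its upper end (a vertex other than the root).  The lexicographic order on addresses
  (with \<open>False < True\<close>) orders pairwise incomparable vertices from left to right.
\<close>

primrec vertices :: "'a tree \<Rightarrow> bool list set"
  where
    "vertices \<langle>\<rangle> = {[]}"
  | "vertices \<langle>l, \<alpha>, r\<rangle> = {[]} \<union> (#) False ` vertices l \<union> (#) True ` vertices r"

primrec interior_vertices :: "'a tree \<Rightarrow> bool list set"
  where
    "interior_vertices \<langle>\<rangle> = {}"
  | "interior_vertices \<langle>l, \<alpha>, r\<rangle> =
       {[]} \<union> (#) False ` interior_vertices l \<union> (#) True ` interior_vertices r"

text \<open>
  The lower end of an edge is always an interior vertex, so only the upper end needs to be checked.
\<close>

definition interior_edges :: "'a tree \<Rightarrow> bool list set"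
  where "interior_edges T = interior_vertices T - {[]}"

definition path_edges :: "bool list \<Rightarrow> bool list set"
  where "path_edges v = {e. e \<noteq> [] \<and> prefix e v}"

definition admissible :: "'a tree \<Rightarrow> bool list set \<Rightarrow> bool"
  where "admissible T c \<longleftrightarrow>
    c \<subseteq> interior_edges T \<and> (\<forall>v\<in>vertices T. card (c \<inter> path_edges v) \<le> 1)"

datatype cut = EdgeCut "bool list set" | TotalCut

definition Adm_star :: "'a tree \<Rightarrow> cut set"
  where "Adm_star T = insert TotalCut (EdgeCut ` {c. admissible T c})"

definition Adm :: "'a tree \<Rightarrow> cut set"
  where "Adm T = Adm_star T - {EdgeCut {}, TotalCut}"

primrec subtree_at :: "bool list \<Rightarrow> 'a tree \<Rightarrow> 'a tree"
  where
    "subtree_at [] T = T"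
  | "subtree_at (d # p) T = subtree_at p (if d then right T else left T)"

primrec root_component :: "bool list set \<Rightarrow> 'a tree \<Rightarrow> 'a tree"
  where
    "root_component c \<langle>\<rangle> = \<langle>\<rangle>"
  | "root_component c \<langle>l, \<alpha>, r\<rangle> =
      \<langle>if [False] \<in> c then \<langle>\<rangle> else root_component {p. False # p \<in> c} l,
       \<alpha>,
       if [True] \<in> c then \<langle>\<rangle> else root_component {p. True # p \<in> c} r\<rangle>"

text \<open>
  The component lying directly above the cut edge \<open>e\<close>: the subtree at \<open>e\<close>, cut in turn at
  those edges of \<open>c\<close> that lie above \<open>e\<close> (for an admissible cut there are none).
\<close>

definition component_above :: "bool list set \<Rightarrow> 'a tree \<Rightarrow> bool list \<Rightarrow> 'a tree"
  where "component_above c T e = root_component {p. p \<noteq> [] \<and> e @ p \<in> c} (subtree_at e T)"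

fun cut_R :: "cut \<Rightarrow> 'a tree \<Rightarrow> 'a tree"
  where
    "cut_R (EdgeCut c) T = root_component c T"
  | "cut_R TotalCut T = \<langle>\<rangle>"

fun cut_P :: "cut \<Rightarrow> 'a tree \<Rightarrow> ('a, 'k::comm_ring_1) H_LR"
  where
    "cut_P (EdgeCut c) T =
       foldr ast (map (\<lambda>e. basis (component_above c T e)) (sorted_list_of_set c)) (basis \<langle>\<rangle>)"
  | "cut_P TotalCut T = basis T"

lemma finite_interior_vertices [simp]: "finite (interior_vertices T)"
  by (induction T) auto

lemma finite_Adm_star: "finite (Adm_star T)"
proof -
  have "{c. admissible T c} \<subseteq> Pow (interior_vertices T)"
    by (auto simp: admissible_def interior_edges_def)
  then show ?thesis
    by (simp add: Adm_star_def finite_subset)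
qed

end

theory Submission
  imports Defs
begin

text \<open>
  Marking a vertex stands for cutting the edge below it, the total cut being the one that marks the
  root. Under this reading the admissible cuts of a tree are exactly the antichains of its interior
  vertices, and an antichain other than the root alone is a pair of antichains, one in each
  subtree. This is the recursion that defines the coproduct; associativity of \<open>\<^bold>*\<close> is what splits
  \<open>P\<^sup>c\<close> into the contributions of the two subtrees.
\<close>

section \<open>Linear and bilinear extension\<close>

text \<open>Multilinear identities are checked on basis elements, with one such induction for each
  argument.\<close>

lemma free_module_induct [case_names basis add scale]:
  fixes x :: "'a \<Rightarrow>\<^sub>0 'k::comm_ring_1"
  assumes "\<And>a. P (basis a)"
    and add: "\<And>x y. P x \<Longrightarrow> P y \<Longrightarrow> P (x + y)"
    and scale: "\<And>c x. P x \<Longrightarrow> P (fscale c x)"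
  shows "P x"
proof -
  \<comment> \<open>Zero needs no case of its own: it is the zero multiple of an arbitrary basis
    element.\<close>
  have "fscale 0 (basis undefined) = (0 :: 'a \<Rightarrow>\<^sub>0 'k)"
    by (rule poly_mapping_eqI) simp
  then have zero: "P 0"
    using scale[of "basis undefined" 0] assms(1) by simp
  have "P (\<Sum>a\<in>A. fscale (Poly_Mapping.lookup x a) (basis a))" if "finite A" for A
    using that by induction (simp_all add: zero assms)
  then show ?thesis
    by (subst basis_expansion) simp
qed

lemma fscale_add: "fscale c (x + y) = fscale c x + fscale c y"
  by (rule poly_mapping_eqI) (simp add: lookup_add algebra_simps)

lemma lin_ext_add: "lin_ext f (x + y) = lin_ext f x + lin_ext f y"
  and lin_ext_fscale: "lin_ext f (fscale c x) = fscale c (lin_ext f x)"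
  and lin_ext_sum: "lin_ext f (\<Sum>i\<in>I. g i) = (\<Sum>i\<in>I. lin_ext f (g i))"
  using lin_ext_linear[of f]
  by (simp_all add: module_hom.add module_hom.scale module_hom.sum)

lemma tensor_add_left: "(x + y) \<otimes> z = x \<otimes> z + y \<otimes> z"
  and tensor_fscale_left: "fscale c x \<otimes> z = fscale c (x \<otimes> z)"
  and tensor_sum_left: "(\<Sum>i\<in>I. g i) \<otimes> z = (\<Sum>i\<in>I. g i \<otimes> z)"
  by (auto intro!: poly_mapping_eqI simp: lookup_add lookup_sum sum_distrib_left algebra_simps)

lemma tensor_add_right: "x \<otimes> (y + z) = x \<otimes> y + x \<otimes> z"
  and tensor_fscale_right: "x \<otimes> fscale c y = fscale c (x \<otimes> y)"
  and tensor_sum_right: "x \<otimes> (\<Sum>i\<in>I. g i) = (\<Sum>i\<in>I. x \<otimes> g i)"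
  by (auto intro!: poly_mapping_eqI simp: lookup_add lookup_sum sum_distrib_left algebra_simps)

lemmas multilinear_simps = fscale_add lin_ext_add lin_ext_fscale
  tensor_add_left tensor_fscale_left tensor_add_right tensor_fscale_right

definition bilinear_map ::
    "(('a \<Rightarrow>\<^sub>0 'k) \<Rightarrow> ('b \<Rightarrow>\<^sub>0 'k) \<Rightarrow> ('c \<Rightarrow>\<^sub>0 'k::comm_ring_1)) \<Rightarrow> bool"
  where "bilinear_map f \<longleftrightarrow>
    (\<forall>x y z. f (x + y) z = f x z + f y z) \<and> (\<forall>c x z. f (fscale c x) z = fscale c (f x z)) \<and>
    (\<forall>x y z. f x (y + z) = f x y + f x z) \<and> (\<forall>c x y. f x (fscale c y) = fscale c (f x y))"

lemma bilinear_mapD: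
  assumes "bilinear_map f"
  shows "f (x + y) z = f x z + f y z" "f (fscale c x) z = fscale c (f x z)"
    "f x (y' + z') = f x y' + f x z'" "f x (fscale c y') = fscale c (f x y')"
  using assms by (auto simp: bilinear_map_def)

lemma bilinear_map_bilin_ext: "bilinear_map (bilin_ext f)"
  by (simp add: bilinear_map_def bilin_ext_def multilinear_simps)

lemma bilin_ext_basis: "bilin_ext f (basis a) (basis b) = f a b"
  by (simp add: bilin_ext_def)

text \<open>\<open>tau23\<close> is given on basis elements only, while the first factors
  \<open>P\<close> of the expansion are products, that is, sums of trees. Both sides are linear in
  each of the four arguments.\<close>

lemma tau23_tensor: "tau23 ((p \<otimes> q) \<otimes> (p' \<otimes> q')) = (p \<otimes> p') \<otimes> (q \<otimes> q')"
proof (induction p rule: free_module_induct)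
  case (basis a)
  show ?case
  proof (induction q rule: free_module_induct)
    case (basis b)
    show ?case
    proof (induction p' rule: free_module_induct)
      case (basis a')
      show ?case
        by (induction q' rule: free_module_induct)
          (simp_all add: tau23_def multilinear_simps)
    qed (simp_all add: tau23_def multilinear_simps)
  qed (simp_all add: tau23_def multilinear_simps)
qed (simp_all add: tau23_def multilinear_simps)

lemma tensor_maps_tensor:
  assumes f: "bilinear_map f" and g: "bilinear_map g"
  shows "tensor_maps f g ((p \<otimes> p') \<otimes> (q \<otimes> q')) = f p p' \<otimes> g q q'"
proof (induction p rule: free_module_induct)
  case (basis a)
  show ?case
  proof (induction q rule: free_module_induct)
    case (basis b)
    show ?case
    proof (induction p' rule: free_module_induct)
      case (basis a')
      show ?case
        by (induction q' rule: free_module_induct)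
          (simp_all add: tensor_maps_def multilinear_simps bilinear_mapD[OF g])
    qed (simp_all add: tensor_maps_def multilinear_simps bilinear_mapD[OF f])
  qed (simp_all add: tensor_maps_def multilinear_simps bilinear_mapD[OF g])
qed (simp_all add: tensor_maps_def multilinear_simps bilinear_mapD[OF f])

section \<open>The associative product\<close>

lemma bilinear_map_ast: "bilinear_map ast"
  by (simp add: ast_def bilinear_map_bilin_ext)

lemma bilinear_map_graft: "bilinear_map (graft \<alpha>)"
  by (simp add: graft_def bilinear_map_bilin_ext)

lemmas ast_graft_simps = bilinear_mapD[OF bilinear_map_ast] bilinear_mapD[OF bilinear_map_graft]
  fscale_add

lemma ast_basis: "basis S \<^bold>* basis T = ast_tree S T"
  by (simp add: ast_def bilin_ext_basis)

lemma graft_basis: "graft \<alpha> (basis l) (basis r) = basis \<langle>l, \<alpha>, r\<rangle>"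
  by (simp add: graft_def bilin_ext_basis)

lemma ast_Leaf_left [simp]: "basis \<langle>\<rangle> \<^bold>* x = x"
  by (induction x rule: free_module_induct) (simp_all add: ast_graft_simps ast_basis)

lemma ast_tree_Leaf_right: "ast_tree T \<langle>\<rangle> = basis T"
  by (cases T) simp_all

lemma ast_Leaf_right [simp]: "x \<^bold>* basis \<langle>\<rangle> = x"
  by (induction x rule: free_module_induct)
    (simp_all add: ast_graft_simps ast_basis ast_tree_Leaf_right)

text \<open>By linearity in the four arguments this reduces to the recursive equation of
  \<open>ast_tree\<close>. In this form the recursion applies again to subterms that are themselves
  products.\<close>

lemma graft_ast_graft:
  "graft \<alpha> u v \<^bold>* graft \<beta> u' v' =
     graft \<alpha> u (v \<^bold>* graft \<beta> u' v') + graft \<beta> (graft \<alpha> u v \<^bold>* u') v'"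
proof (induction u rule: free_module_induct)
  case (basis a)
  show ?case
  proof (induction v rule: free_module_induct)
    case (basis b)
    show ?case
    proof (induction u' rule: free_module_induct)
      case (basis a')
      show ?case
        by (induction v' rule: free_module_induct)
          (simp_all add: ast_graft_simps ast_basis graft_basis)
    qed (simp_all add: ast_graft_simps)
  qed (simp_all add: ast_graft_simps)
qed (simp_all add: ast_graft_simps)

text \<open>Induction on the total number of interior vertices. Both bracketings expand into three
  terms, according to which of the three roots becomes the root of the result. The terms with root
  \<beta> agree; the other two agree by the induction hypothesis, with \<open>S\<close> replaced by
  its right subtree or \<open>U\<close> by its left subtree.\<close>

lemma ast_assoc_basis:
  "((basis S \<^bold>* basis T) \<^bold>* basis U :: ('a, 'k::comm_ring_1) H_LR) = basis S \<^bold>* basis T \<^bold>* basis U"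
proof (induction "size S + size T + size U" arbitrary: S T U rule: less_induct)
  case less
  show ?case
  proof (cases "S = \<langle>\<rangle> \<or> T = \<langle>\<rangle> \<or> U = \<langle>\<rangle>")
    case True
    then show ?thesis by auto
  next
    case False
    then obtain l \<alpha> r l' \<beta> r' l'' \<gamma> r''
      where trees: "S = \<langle>l, \<alpha>, r\<rangle>" "T = \<langle>l', \<beta>, r'\<rangle>" "U = \<langle>l'', \<gamma>, r''\<rangle>"
      by (meson tree.exhaust)
    define x y z :: "('a, 'k) H_LR"
      where "x = basis S" and "y = basis T" and "z = basis U"
    have x: "x = graft \<alpha> (basis l) (basis r)" and y: "y = graft \<beta> (basis l') (basis r')"
      and z: "z = graft \<gamma> (basis l'') (basis r'')"
      by (simp_all add: x_def y_def z_def trees graft_basis)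
    have xy: "x \<^bold>* y = graft \<alpha> (basis l) (basis r \<^bold>* y) + graft \<beta> (x \<^bold>* basis l') (basis r')"
      unfolding x y by (rule graft_ast_graft)
    have yz: "y \<^bold>* z = graft \<beta> (basis l') (basis r' \<^bold>* z) + graft \<gamma> (y \<^bold>* basis l'') (basis r'')"
      unfolding y z by (rule graft_ast_graft)
    \<comment> \<open>Multiplying each summand of \<open>xy\<close> by \<open>z\<close> yields a
      term with root \<gamma>; the two add up to the single one containing the whole product of
      \<open>x\<close> and \<open>y\<close>.\<close>
    have "(x \<^bold>* y) \<^bold>* z = graft \<alpha> (basis l) ((basis r \<^bold>* y) \<^bold>* z)
        + graft \<beta> (x \<^bold>* basis l') (basis r' \<^bold>* z) + graft \<gamma> ((x \<^bold>* y) \<^bold>* basis l'') (basis r'')"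
      unfolding xy z by (simp add: graft_ast_graft ast_graft_simps algebra_simps)
    moreover have "(basis r \<^bold>* y) \<^bold>* z = basis r \<^bold>* y \<^bold>* z"
      unfolding y_def z_def by (rule less) (simp add: trees)
    moreover have "(x \<^bold>* y) \<^bold>* basis l'' = x \<^bold>* y \<^bold>* basis l''"
      unfolding x_def y_def by (rule less) (simp add: trees)
    moreover have "x \<^bold>* y \<^bold>* z = graft \<alpha> (basis l) (basis r \<^bold>* y \<^bold>* z)
        + graft \<beta> (x \<^bold>* basis l') (basis r' \<^bold>* z) + graft \<gamma> (x \<^bold>* y \<^bold>* basis l'') (basis r'')"
      unfolding yz x by (simp add: graft_ast_graft ast_graft_simps algebra_simps)
    ultimately show ?thesis
      by (simp add: x_def y_def z_def)
  qed
qed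

lemma ast_assoc: "(x \<^bold>* y) \<^bold>* z = x \<^bold>* y \<^bold>* z"
proof (induction x rule: free_module_induct)
  case (basis S)
  show ?case
  proof (induction y rule: free_module_induct)
    case (basis T)
    show ?case
      by (induction z rule: free_module_induct) (simp_all add: ast_graft_simps ast_assoc_basis)
  qed (simp_all add: ast_graft_simps)
qed (simp_all add: ast_graft_simps)

lemma foldr_ast_append:
  "foldr ast (xs @ ys) (basis \<langle>\<rangle>) = foldr ast xs (basis \<langle>\<rangle>) \<^bold>* foldr ast ys (basis \<langle>\<rangle>)"
  by (induction xs) (simp_all add: ast_assoc)

section \<open>Admissible cuts as antichains\<close>

definition antichains :: "'a tree \<Rightarrow> bool list set set"
  where "antichains T =
    {c. c \<subseteq> interior_vertices T \<and> (\<forall>e\<in>c. \<forall>f\<in>c. prefix e f \<longrightarrow> e = f)}"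

definition join :: "bool list set \<times> bool list set \<Rightarrow> bool list set"
  where "join = (\<lambda>(c, d). (#) False ` c \<union> (#) True ` d)"

lemma in_join [simp]:
  "[] \<notin> join (c, d)" "False # p \<in> join (c, d) \<longleftrightarrow> p \<in> c" "True # p \<in> join (c, d) \<longleftrightarrow> p \<in> d"
  by (auto simp: join_def)

lemma inj_join: "inj join"
proof (rule injI, safe)
  fix c d c' d' :: "bool list set" and p
  assume "join (c, d) = join (c', d')"
  then have "p \<in> c \<longleftrightarrow> p \<in> c'" "p \<in> d \<longleftrightarrow> p \<in> d'" for p
    by (metis in_join(2), metis in_join(3))
  then show "p \<in> c \<Longrightarrow> p \<in> c'" "p \<in> c' \<Longrightarrow> p \<in> c" "p \<in> d \<Longrightarrow> p \<in> d'" "p \<in> d' \<Longrightarrow> p \<in> d"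
    by blast+
qed

lemma finite_antichains: "finite (antichains T)"
  by (rule finite_subset[of _ "Pow (interior_vertices T)"]) (auto simp: antichains_def)

lemma finite_antichain: "c \<in> antichains T \<Longrightarrow> finite c"
  by (auto simp: antichains_def intro: finite_subset)

text \<open>The root address is a prefix of every address, hence comparable with every
  vertex.\<close>

lemma antichain_with_root:
  assumes "c \<in> antichains T" "[] \<in> c"
  shows "c = {[]}"
proof -
  have "e = []" if "e \<in> c" for e
    using assms that Nil_prefix[of e] unfolding antichains_def by blast
  then show ?thesis using assms(2) by blast
qed

lemma antichains_Leaf: "antichains \<langle>\<rangle> = {{}}"
  by (auto simp: antichains_def)

text \<open>Addresses with different first entries are incomparable, and removing a common first
  entry preserves the prefix relation; so the two sides can be chosen independently. The two kinds
  of antichain match the two summands of \<open>Delta_tree\<close> at a node.\<close>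

lemma antichains_Node:
  "antichains \<langle>l, \<alpha>, r\<rangle> = insert {[]} (join ` (antichains l \<times> antichains r))"
proof (rule set_eqI, rule iffI)
  fix c
  assume c: "c \<in> antichains \<langle>l, \<alpha>, r\<rangle>"
  show "c \<in> insert {[]} (join ` (antichains l \<times> antichains r))"
  proof (cases "[] \<in> c")
    case True
    then have "c = {[]}" using c antichain_with_root by blast
    then show ?thesis by simp
  next
    case False
    have "c = join ({p. False # p \<in> c}, {p. True # p \<in> c})"
    proof (rule set_eqI)
      fix e show "e \<in> c \<longleftrightarrow> e \<in> join ({p. False # p \<in> c}, {p. True # p \<in> c})"
        using False by (cases e rule: list.exhaust; cases "hd e") auto
    qed
    moreover have "{p. False # p \<in> c} \<in> antichains l" "{p. True # p \<in> c} \<in> antichains r"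
      using c by (fastforce simp: antichains_def)+
    ultimately show ?thesis by blast
  qed
next
  fix c
  assume "c \<in> insert {[]} (join ` (antichains l \<times> antichains r))"
  then show "c \<in> antichains \<langle>l, \<alpha>, r\<rangle>"
    by (auto simp: antichains_def join_def)
qed

text \<open>If \<open>e\<close> is a prefix of \<open>f\<close>, both lie on the path to
  \<open>f\<close>, so admissibility forces them to be equal. Conversely, the prefixes of a fixed
  address form a chain, which an antichain meets at most once.\<close>

lemma admissible_iff_antichain: "admissible T c \<longleftrightarrow> c \<in> antichains T \<and> [] \<notin> c"
proof
  \<comment> \<open>Needed because the path condition below is applied to a member of the cut, taken
    as a vertex.\<close>
  have interior: "interior_vertices T \<subseteq> vertices T"
    by (induction T) auto
  assume adm: "admissible T c"
  then have c: "c \<subseteq> interior_vertices T" "[] \<notin> c"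
    by (auto simp: admissible_def interior_edges_def)
  moreover have "e = f" if "e \<in> c" "f \<in> c" "prefix e f" for e f
  proof -
    have "card (c \<inter> path_edges f) \<le> Suc 0" "finite (c \<inter> path_edges f)"
      using adm c interior that by (auto simp: admissible_def intro: finite_subset)
    moreover have "e \<in> c \<inter> path_edges f" "f \<in> c \<inter> path_edges f"
      using that c by (auto simp: path_edges_def)
    ultimately show ?thesis
      by (simp add: card_le_Suc0_iff_eq)
  qed
  ultimately show "c \<in> antichains T \<and> [] \<notin> c"
    by (auto simp: antichains_def)
next
  assume c: "c \<in> antichains T \<and> [] \<notin> c"
  have "card (c \<inter> path_edges v) \<le> Suc 0" for v
  proof -
    have "finite (c \<inter> path_edges v)"
      using c finite_antichain by blast
    moreover have "e = f" if "e \<in> c \<inter> path_edges v" "f \<in> c \<inter> path_edges v" for e f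
      using that c prefix_same_cases[of e v f] by (auto simp: antichains_def path_edges_def)
    ultimately show ?thesis
      by (simp add: card_le_Suc0_iff_eq)
  qed
  then show "admissible T c"
    using c by (auto simp: admissible_def antichains_def interior_edges_def)
qed

section \<open>The two tensor factors of an antichain, and the expansion of the coproduct\<close>

definition antichain_P :: "bool list set \<Rightarrow> 'a tree \<Rightarrow> ('a, 'k::comm_ring_1) H_LR"
  where "antichain_P c T =
    foldr ast (map (\<lambda>e. basis (subtree_at e T)) (sorted_list_of_set c)) (basis \<langle>\<rangle>)"

text \<open>At a node, \<open>root_component\<close> tests whether a child is cut off; here a tree
  tests its own root. Moving the test into the subtree makes the construction commute with
  \<open>join\<close>, also when a whole subtree is removed.\<close>

definition antichain_R :: "bool list set \<Rightarrow> 'a tree \<Rightarrow> 'a tree"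
  where "antichain_R c T = (if [] \<in> c then \<langle>\<rangle> else root_component c T)"

lemma root_component_empty [simp]: "root_component {} T = T"
  by (induction T) auto

text \<open>Since \<open>False < True\<close>, every address on the left precedes every address on
  the right, and a common first entry does not affect the order.\<close>

lemma sorted_list_of_join:
  assumes "finite c" "finite d"
  shows "sorted_list_of_set (join (c, d)) =
    map ((#) False) (sorted_list_of_set c) @ map ((#) True) (sorted_list_of_set d)"
proof (rule sorted_list_of_set_unique[THEN iffD1])
  have "sorted (map ((#) b) xs)" if "sorted xs" for b :: bool and xs
    using that by (induction xs) auto
  moreover have "sorted_wrt (<) xs \<longleftrightarrow> sorted xs \<and> distinct xs" for xs :: "bool list list"
    by (rule strict_sorted_iff)
  moreover have "(#) False ` c \<inter> (#) True ` d = {}"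
    by auto
  ultimately show "sorted_wrt (<) (map ((#) False) (sorted_list_of_set c) @
      map ((#) True) (sorted_list_of_set d))
    \<and> set (map ((#) False) (sorted_list_of_set c) @ map ((#) True) (sorted_list_of_set d))
      = join (c, d)
    \<and> length (map ((#) False) (sorted_list_of_set c) @ map ((#) True) (sorted_list_of_set d))
      = card (join (c, d))"
    using assms
    by (auto simp: join_def sorted_append distinct_map card_Un_disjoint card_image)
qed (use assms in \<open>auto simp: join_def\<close>)

lemma antichain_P_join:
  assumes "finite c" "finite d"
  shows "antichain_P (join (c, d)) \<langle>l, \<alpha>, r\<rangle> = antichain_P c l \<^bold>* antichain_P d r"
  using assms by (simp add: antichain_P_def sorted_list_of_join foldr_ast_append o_def del: foldr_append)

lemma antichain_R_join:
  "antichain_R (join (c, d)) \<langle>l, \<alpha>, r\<rangle> = \<langle>antichain_R c l, \<alpha>, antichain_R d r\<rangle>"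
  by (simp add: antichain_R_def)

text \<open>Antichains make the induction start correctly: the leaf has a single one, the empty set,
  whereas \<open>Adm_star\<close> of the leaf contains both the empty and the total cut and would
  count the term twice.\<close>

lemma Delta_tree_antichains:
  "(Delta_tree T :: 'a tree \<times> 'a tree \<Rightarrow>\<^sub>0 'k::comm_ring_1) =
     (\<Sum>c\<in>antichains T. antichain_P c T \<otimes> basis (antichain_R c T))"
proof (induction T)
  case Leaf
  show ?case by (simp add: antichains_Leaf antichain_P_def antichain_R_def)
next
  case (Node l \<alpha> r)
  let ?t = "\<lambda>c T. antichain_P c T \<otimes> basis (antichain_R c T) :: 'a tree \<times> 'a tree \<Rightarrow>\<^sub>0 'k"
  let ?LR = "antichains l \<times> antichains r"
  have lin: "tensor_maps ast (graft \<alpha>) (tau23 (\<Sum>i\<in>I. g i)) =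
      (\<Sum>i\<in>I. tensor_maps ast (graft \<alpha>) (tau23 (g i)))" for I g
    by (simp add: tensor_maps_def tau23_def lin_ext_sum)
  have "tensor_maps ast (graft \<alpha>) (tau23 (Delta_tree l \<otimes> Delta_tree r)) =
      (\<Sum>(c, d)\<in>?LR. tensor_maps ast (graft \<alpha>) (tau23 (?t c l \<otimes> ?t d r)))"
    unfolding Node.IH tensor_sum_left
    unfolding tensor_sum_right lin sum.cartesian_product by (simp only: split_def)
  \<comment> \<open>For each pair, \<open>tau23\<close> brings the two \<open>P\<close> factors
    together and the two \<open>R\<close> factors together; \<open>ast\<close> and
    \<open>graft\<close> then produce the factors of the joined antichain.\<close>
  also have "\<dots> = (\<Sum>p\<in>?LR. ?t (join p) \<langle>l, \<alpha>, r\<rangle>)"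
    by (intro sum.cong refl)
      (auto simp del: tensor_basis simp: tau23_tensor antichain_R_join graft_basis finite_antichain
        antichain_P_join tensor_maps_tensor[OF bilinear_map_ast bilinear_map_graft])
  also have "\<dots> = (\<Sum>c\<in>join ` ?LR. ?t c \<langle>l, \<alpha>, r\<rangle>)"
    by (simp add: sum.reindex inj_on_subset[OF inj_join])
  finally have "Delta_tree \<langle>l, \<alpha>, r\<rangle> =
      ?t {[]} \<langle>l, \<alpha>, r\<rangle> + (\<Sum>c\<in>join ` ?LR. ?t c \<langle>l, \<alpha>, r\<rangle>)"
    by (simp add: antichain_P_def antichain_R_def)
  moreover have "{[]} \<notin> join ` ?LR"
    using in_join(1) by (metis imageE singletonI surj_pair)
  ultimately show ?case
    by (simp add: antichains_Node finite_antichains)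
qed

section \<open>Return from antichains to cuts\<close>

lemma cut_P_EdgeCut:
  fixes T :: "'a tree"
  assumes "c \<in> antichains T"
  shows "(cut_P (EdgeCut c) T :: ('a, 'k::comm_ring_1) H_LR) = antichain_P c T"
proof -
  \<comment> \<open>No member of an antichain lies above another, so the components above the cut
    edges are whole subtrees.\<close>
  have "{p. p \<noteq> [] \<and> e @ p \<in> c} = {}" if "e \<in> c" for e
    using assms that by (force simp: antichains_def)
  then have "component_above c T e = subtree_at e T" if "e \<in> c" for e
    using that by (simp only: component_above_def root_component_empty)
  then have "map (\<lambda>e. basis (component_above c T e)) (sorted_list_of_set c) =
      (map (\<lambda>e. basis (subtree_at e T)) (sorted_list_of_set c) :: ('a, 'k) H_LR list)"
    using finite_antichain[OF assms] by simp
  then show ?thesis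
    by (simp only: cut_P.simps antichain_P_def)
qed

text \<open>The antichain consisting of the root corresponds to \<open>TotalCut\<close>, every other
  one to the edge cut with the same set. The root is available as an interior vertex because the
  tree is not a leaf.\<close>

lemma sum_antichains_eq_sum_cuts:
  fixes T :: "'a tree"
  assumes "T \<noteq> \<langle>\<rangle>"
  shows "(\<Sum>c\<in>antichains T. antichain_P c T \<otimes> basis (antichain_R c T) ::
      'a tree \<times> 'a tree \<Rightarrow>\<^sub>0 'k::comm_ring_1) =
    (\<Sum>c\<in>Adm_star T. cut_P c T \<otimes> basis (cut_R c T))"
proof -
  let ?A = "{c. admissible T c}"
  have "{[]} \<in> antichains T"
    using assms by (cases T) (simp_all add: antichains_Node)
  then have "antichains T = insert {[]} ?A"
    using antichain_with_root by (auto simp: admissible_iff_antichain)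
  moreover have "finite ?A"
    by (rule finite_subset[OF _ finite_antichains[of T]]) (auto simp: admissible_iff_antichain)
  moreover have "{[]} \<notin> ?A"
    by (simp add: admissible_iff_antichain)
  moreover have "(\<Sum>c\<in>?A. antichain_P c T \<otimes> basis (antichain_R c T) ::
      'a tree \<times> 'a tree \<Rightarrow>\<^sub>0 'k) =
      (\<Sum>c\<in>?A. cut_P (EdgeCut c) T \<otimes> basis (cut_R (EdgeCut c) T))"
    by (intro sum.cong refl) (auto simp: admissible_iff_antichain cut_P_EdgeCut antichain_R_def
        simp del: cut_P.simps)
  moreover have "antichain_P {[]} T = (cut_P TotalCut T :: ('a, 'k) H_LR)"
    "antichain_R {[]} T = cut_R TotalCut T"
    by (simp_all add: antichain_P_def antichain_R_def)
  ultimately show ?thesis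
    by (simp add: Adm_star_def sum.reindex inj_on_def image_iff del: cut_P.simps cut_R.simps)
qed

theorem theorem2p6:
  fixes T :: "'a tree"
  assumes "T \<noteq> \<langle>\<rangle>"
  shows "(Delta_LR (basis T) :: 'a tree \<times> 'a tree \<Rightarrow>\<^sub>0 'k::comm_ring_1)
           = (\<Sum>c\<in>Adm_star T. cut_P c T \<otimes> basis (cut_R c T))
       \<and> ((\<Sum>c\<in>Adm_star T. cut_P c T \<otimes> basis (cut_R c T)) :: 'a tree \<times> 'a tree \<Rightarrow>\<^sub>0 'k)
           = basis T \<otimes> basis \<langle>\<rangle> + basis \<langle>\<rangle> \<otimes> basis T
             + (\<Sum>c\<in>Adm T. cut_P c T \<otimes> basis (cut_R c T))"
proof
  show "(Delta_LR (basis T) :: 'a tree \<times> 'a tree \<Rightarrow>\<^sub>0 'k)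
      = (\<Sum>c\<in>Adm_star T. cut_P c T \<otimes> basis (cut_R c T))"
    by (simp only: Delta_LR_def lin_ext_basis Delta_tree_antichains
        sum_antichains_eq_sum_cuts[OF assms])
next
  have "EdgeCut {} \<in> Adm_star T" "TotalCut \<in> Adm_star T"
    by (auto simp: Adm_star_def admissible_def)
  \<comment> \<open>The total cut contributes the term with \<open>T\<close> on the left; the empty
    cut, which leaves \<open>T\<close> whole with an empty product, contributes the one with
    \<open>T\<close> on the right.\<close>
  then have "Adm_star T = insert TotalCut (insert (EdgeCut {}) (Adm T))"
    by (auto simp: Adm_def)
  moreover have "finite (Adm T)" "EdgeCut {} \<notin> Adm T" "TotalCut \<notin> Adm T"
    by (simp_all add: Adm_def finite_Adm_star)
  ultimately show "((\<Sum>c\<in>Adm_star T. cut_P c T \<otimes> basis (cut_R c T)) :: 'a tree \<times> 'a tree \<Rightarrow>\<^sub>0 'k)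
      = basis T \<otimes> basis \<langle>\<rangle> + basis \<langle>\<rangle> \<otimes> basis T
        + (\<Sum>c\<in>Adm T. cut_P c T \<otimes> basis (cut_R c T))"
    by (simp add: add.assoc)
qed

end
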